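(* Let $k\ge 1$ and let $C\subset F_2^n$ be a binary orthogonal array of strength $2k$ such that $D(C)\subseteq\overline{C}$. Let $$f(t)=\left(t+1-\frac2n\right)\bigl(t-\rho(C)\bigr)A^2(t),$$ where $A(t)$ is a real polynomial of degree $k-1$, and let $f_0=\int f\,d\mu_n$. Then $$f_0|C|-f(-1)\le 0,$$ and, consequently, $$\rho(C)\ge q_k(n,|C|),\qquad q_k(n,|C|):=\frac{|C|\,a-\frac2n A(-1)^2}{|C|\,b+\frac2n A(-1)^2},$$ where $a=\int t\left(t+1-\frac2n\right)A^2(t)\,d\mu_n(t)$ and $b=\int\left(t+1-\frac2n\right)A^2(t)\,d\mu_n(t)$; moreover, the two displayed inequalities are equivalent.
   Context: $F_2=\{0,1\}$, and $F_2^n$ ($n\ge 2$) carries the Hamming distance $d(x,y)$. A code is a nonempty subset of $F_2^n$ (a set, without repeated words). A code $C\subset F_2^n$ with $M=|C|$ is a binary orthogonal array of strength $\tau$ ($1\le\tau\le n$) if in the $M\times n$ matrix whose rows are the codewords, every $M\times\tau$ submatrix contains every element of $F_2^\tau$ as a row exactly $M/2^\tau$ times. For $x,y\in F_2^n$ put $\langle x,y\rangle=1-2d(x,y)/n$. Let $\rho(C)=\min_{y\in F_2^n}\max_{x\in C}\langle x,y\rangle$ (so $\rho(C)=1-2R(C)/n$ with $R(C)$ the usual covering radius $\max_y\min_{x\in C}d(x,y)$), and $D(C)=\{y\in F_2^n:\max_{x\in C}\langle x,y\rangle=\rho(C)\}$. Let $\overline{C}=\{u\in F_2^n:\exists x\in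 C,\ d(x,u)=n\}$ be the set of antipodes of points of $C$. $\mu_n=2^{-n}\sum_{i=0}^n\binom ni\delta_{t_i}$ with $t_i=-1+2i/n$. For a polynomial $f$, $f_0=\int f\,d\mu_n=2^{-n}\sum_{i=0}^n\binom ni f(t_i)$. *)

theory Defs
  imports "HOL-Analysis.Analysis" "HOL-Library.Z2" "HOL-Computational_Algebra.Polynomial"
begin

text \<open>
  The Hamming space of dimension n over the two-element field is the type \<open>bit ^ 'n\<close>,
  with n being \<open>CARD('n)\<close>.
\<close>

text \<open>This makes \<open>bit ^ 'n\<close> a finite type, so that the minima and maxima below exist.\<close>

instance bit :: finite
proof
  have "(UNIV :: bit set) \<subseteq> {0, 1}"
    by (metis (full_types) bit_not_zero_iff insertCI subsetI)
  then show "finite (UNIV :: bit set)"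
    by (rule finite_subset) simp
qed

definition hamming :: "bit ^ 'n \<Rightarrow> bit ^ 'n \<Rightarrow> nat"
  where "hamming x y = card {i. x $ i \<noteq> y $ i}"

definition ham_ip :: "bit ^ 'n \<Rightarrow> bit ^ 'n \<Rightarrow> real"
  where "ham_ip x y = 1 - 2 * real (hamming x y) / real CARD('n)"

text \<open>
  \<open>S\<close> is the set of selected columns. Only the coordinates of \<open>p\<close> in \<open>S\<close> are used, so \<open>p\<close>
  ranges (with repetitions) over all the words of length \<open>\<tau>\<close> indexed by \<open>S\<close>.
\<close>

definition orthogonal_array :: "nat \<Rightarrow> (bit ^ 'n) set \<Rightarrow> bool"
  where "orthogonal_array \<tau> C \<longleftrightarrow>
    C \<noteq> {} \<and> 1 \<le> \<tau> \<and> \<tau> \<le> CARD('n) \<and>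
    (\<forall>S :: 'n set. card S = \<tau> \<longrightarrow>
      (\<forall>p :: bit ^ 'n. real (card {x \<in> C. \<forall>i\<in>S. x $ i = p $ i}) = real (card C) / 2 ^ \<tau>))"

text \<open>The covering radius in terms of inner products; meaningful for nonempty codes only.\<close>

definition cov_rho :: "(bit ^ 'n) set \<Rightarrow> real"
  where "cov_rho C = (MIN y. MAX x\<in>C. ham_ip x y)"

definition deep_holes :: "(bit ^ 'n) set \<Rightarrow> (bit ^ 'n) set"
  where "deep_holes C = {y. (MAX x\<in>C. ham_ip x y) = cov_rho C}"

definition antipodes :: "(bit ^ 'n) set \<Rightarrow> (bit ^ 'n) set"
  where "antipodes C = {u. \<exists>x\<in>C. hamming x u = CARD('n)}"

text \<open>
  The discrete measure with mass \<open>(n choose i) / 2 ^ n\<close> at \<open>-1 + 2 * i / n\<close> for \<open>i = 0, \<dots>, n\<close>,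
  as the image of a weighted counting measure on the indices.
\<close>

definition mu :: "nat \<Rightarrow> real measure"
  where "mu n = distr (point_measure {0..n} (\<lambda>i. ennreal (real (n choose i) / 2 ^ n))) borel
                  (\<lambda>i. -1 + 2 * real i / real n)"

lemma integral_mu:
  fixes g :: "real \<Rightarrow> real"
  assumes "g \<in> borel_measurable borel"
  shows "(\<integral>t. g t \<partial>mu n) = (\<Sum>i=0..n. real (n choose i) * g (-1 + 2 * real i / real n)) / 2 ^ n"
  unfolding mu_def using assms
  by (subst integral_distr)
     (simp_all add: lebesgue_integral_point_measure_finite sum_divide_distrib)

text \<open>
  The polynomial \<open>(t + 1 - 2/n) (t - r) A(t)^2\<close>. The point \<open>r\<close> is a parameter; it is the value
  \<open>cov_rho C\<close> in the application to a code \<open>C\<close>.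
\<close>

definition test_poly :: "nat \<Rightarrow> real \<Rightarrow> real poly \<Rightarrow> real poly"
  where "test_poly n r A = [:1 - 2 / real n, 1:] * [:- r, 1:] * A ^ 2"

definition q_bound :: "nat \<Rightarrow> nat \<Rightarrow> real poly \<Rightarrow> real"
  where "q_bound n M A =
    (let a = (\<integral>t. t * (t + 1 - 2 / real n) * (poly A t)\<^sup>2 \<partial>mu n);
         b = (\<integral>t. (t + 1 - 2 / real n) * (poly A t)\<^sup>2 \<partial>mu n)
     in (real M * a - 2 / real n * (poly A (-1))\<^sup>2) / (real M * b + 2 / real n * (poly A (-1))\<^sup>2))"

end

theory Submission
  imports Defs
begin

text \<open>
  For an orthogonal array of strength \<open>\<tau>\<close> and a polynomial \<open>p\<close> of degree at most \<open>\<tau>\<close>, the average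
  of \<open>p (ham_ip x y)\<close> over the codewords \<open>x\<close> is the integral of \<open>p\<close>, whatever the word \<open>y\<close> is.
  Take for \<open>y\<close> a deep hole: exactly one codeword is antipodal to \<open>y\<close> and the inner products of the
  other ones lie in \<open>[-1 + 2/n, \<rho>]\<close>, where the test polynomial is nonpositive; this is the first
  inequality. Its left-hand side is affine in \<open>\<rho>\<close>, so the equivalence amounts to the positivity of the
  denominator of \<open>q_k\<close>. With \<open>y\<close> the antipode of a codeword, it is the sum of \<open>(t + 1 - 2/n) A(t)\<^sup>2\<close> over the other
  codewords; were it zero, every nonnegative term would vanish, hence also the average of
  \<open>(t + 1) (t + 1 - 2/n) A(t)\<^sup>2\<close>, forcing \<open>A\<close> to vanish at \<open>n - 1 > k - 1\<close> points.
\<close>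

section \<open>Orthogonal arrays and moments of the Hamming distance\<close>

lemma CARD_bit: "CARD(bit) = 2"
proof -
  have *: "(UNIV :: bit set) = {0, 1}"
    by (metis (full_types) UNIV_eq_I bit_not_zero_iff insertCI)
  show ?thesis
    by (subst *) simp
qed

lemma bit_neq_iff: "a \<noteq> b \<longleftrightarrow> a = b + 1" for a b :: bit
  by (cases a; cases b) simp_all

text \<open>Strength passes down to fewer columns, by induction on the number of missing ones: a new
  column \<open>j\<close> splits the words by their bit at \<open>j\<close>, and the induction
  hypothesis counts both halves.\<close>

lemma orthogonal_array_card:
  fixes C :: "(bit ^ 'n) set" and p :: "bit ^ 'n"
  assumes "orthogonal_array \<tau> C" "card S \<le> \<tau>"
  shows "real (card {x \<in> C. \<forall>i\<in>S. x $ i = p $ i}) = real (card C) / 2 ^ card S"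
  using assms(2)
proof (induction "\<tau> - card S" arbitrary: S p)
  case 0
  then show ?case
    using assms(1) by (simp add: orthogonal_array_def)
next
  case (Suc m)
  have "card S < CARD('n)"
    using Suc assms(1) by (auto simp: orthogonal_array_def)
  then obtain j where j: "j \<notin> S"
    by (metis UNIV_eq_I less_irrefl)
  have *: "real (card {x \<in> C. \<forall>i\<in>insert j S. x $ i = (\<chi> i. if i = j then b else p $ i) $ i})
      = real (card C) / 2 ^ Suc (card S)" for b
    using Suc.hyps Suc.prems j by (subst Suc.hyps(1)) auto
  have eq: "{x \<in> C. \<forall>i\<in>insert j S. x $ i = (\<chi> i. if i = j then b else p $ i) $ i}
      = {x \<in> C. (\<forall>i\<in>S. x $ i = p $ i) \<and> x $ j = b}" for b
    using j by auto
  have "{x \<in> C. \<forall>i\<in>S. x $ i = p $ i} =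
      {x \<in> C. (\<forall>i\<in>S. x $ i = p $ i) \<and> x $ j = 0} \<union> {x \<in> C. (\<forall>i\<in>S. x $ i = p $ i) \<and> x $ j = 1}"
    by (auto simp: bit_not_zero_iff)
  then have "card {x \<in> C. \<forall>i\<in>S. x $ i = p $ i} =
      card {x \<in> C. (\<forall>i\<in>S. x $ i = p $ i) \<and> x $ j = 0}
      + card {x \<in> C. (\<forall>i\<in>S. x $ i = p $ i) \<and> x $ j = 1}"
    by (simp only:) (rule card_Un_disjoint; auto)
  then show ?case
    using *[of 0] *[of 1] unfolding eq by simp
qed

text \<open>Makes the same counts available for the whole space, with which \<open>C\<close> is
  compared.\<close>

lemma orthogonal_array_UNIV: "orthogonal_array CARD('n) (UNIV :: (bit ^ 'n) set)"
proof -
  have "{x. \<forall>i. x $ i = p $ i} = {p}" for p :: "bit ^ 'n"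
    by (auto simp: vec_eq_iff)
  moreover have "S = UNIV" if "card S = CARD('n)" for S :: "'n set"
    using that by (simp add: card_eq_UNIV_imp_eq_UNIV)
  ultimately have "card {x. \<forall>i\<in>S. x $ i = p $ i} = 1" if "card S = CARD('n)"
    for S and p :: "bit ^ 'n"
    using that by fastforce
  then show ?thesis
    by (simp add: orthogonal_array_def CARD_bit Suc_le_eq)
qed

text \<open>The set \<open>T\<close> is there for the induction on \<open>m\<close>: the distance is
  a sum of indicators of coordinates, so peeling off one factor trades a unit of \<open>m\<close>
  for at most one more column in \<open>T\<close>.\<close>

lemma sum_hamming_power:
  fixes C :: "(bit ^ 'n) set" and y :: "bit ^ 'n"
  assumes "orthogonal_array \<tau> C" "card T + m \<le> \<tau>"
  shows "(\<Sum>x | x \<in> C \<and> (\<forall>i\<in>T. x $ i \<noteq> y $ i). real (hamming x y) ^ m) =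
    real (card C) / 2 ^ CARD('n) * (\<Sum>x | \<forall>i\<in>T. x $ i \<noteq> y $ i. real (hamming x y) ^ m)"
  using assms(2)
proof (induction m arbitrary: T)
  case 0
  have "CARD('n) \<ge> card T"
    by (simp add: card_mono)
  \<comment> \<open>Differing from \<open>y\<close> on \<open>T\<close> is agreeing there with the
    antipode of \<open>y\<close>, so both sides count words with a prescribed pattern.\<close>
  moreover have "(\<forall>i\<in>T. x $ i \<noteq> y $ i) \<longleftrightarrow> (\<forall>i\<in>T. x $ i = (\<chi> i. y $ i + 1) $ i)" for x :: "bit ^ 'n"
    by (simp add: bit_neq_iff)
  ultimately show ?case
    using orthogonal_array_card[OF assms(1), of T "\<chi> i. y $ i + 1"]
      orthogonal_array_card[OF orthogonal_array_UNIV, of T "\<chi> i. y $ i + 1"] 0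
    by (simp add: CARD_bit del: vec_lambda_beta)
next
  case (Suc m)
  have step: "(\<Sum>x | x \<in> B \<and> (\<forall>i\<in>T. x $ i \<noteq> y $ i). real (hamming x y) ^ Suc m) =
      (\<Sum>j\<in>UNIV. \<Sum>x | x \<in> B \<and> (\<forall>i\<in>insert j T. x $ i \<noteq> y $ i). real (hamming x y) ^ m)"
    for B :: "(bit ^ 'n) set"
  proof -
    have ham: "real (hamming x y) = (\<Sum>j\<in>UNIV. if x $ j \<noteq> y $ j then 1 else 0)" for x :: "bit ^ 'n"
      by (simp add: hamming_def flip: sum.inter_filter)
    have "(\<Sum>x | x \<in> B \<and> (\<forall>i\<in>T. x $ i \<noteq> y $ i). real (hamming x y) ^ Suc m) =
      (\<Sum>x | x \<in> B \<and> (\<forall>i\<in>T. x $ i \<noteq> y $ i). \<Sum>j\<in>UNIV.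
        if x $ j \<noteq> y $ j then real (hamming x y) ^ m else 0)"
      unfolding power_Suc by (subst ham) (auto simp: sum_distrib_right intro!: sum.cong)
    also have "\<dots> = (\<Sum>j\<in>UNIV. \<Sum>x | x \<in> B \<and> (\<forall>i\<in>T. x $ i \<noteq> y $ i).
        if x $ j \<noteq> y $ j then real (hamming x y) ^ m else 0)"
      by (rule sum.swap)
    also have "\<dots> = (\<Sum>j\<in>UNIV. \<Sum>x | x \<in> B \<and> (\<forall>i\<in>insert j T. x $ i \<noteq> y $ i).
        real (hamming x y) ^ m)"
      by (subst sum.inter_filter[symmetric]) (auto intro!: sum.cong)
    finally show ?thesis .
  qed
  have "card (insert j T) + m \<le> \<tau>" for j
    using Suc.prems card_insert_le_m1[of "Suc (card T)" T j] by simp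
  then show ?case
    using step[of C] step[of UNIV] by (simp only: Suc.IH sum_distrib_left UNIV_I simp_thms)
qed

section \<open>Averages of polynomials and the measure \<open>mu\<close>\<close>

lemma sum_hamming_UNIV:
  fixes y :: "bit ^ 'n" and h :: "nat \<Rightarrow> real"
  shows "(\<Sum>x\<in>UNIV. h (hamming x y)) = (\<Sum>j=0..CARD('n). real (CARD('n) choose j) * h j)"
proof -
  have le: "hamming x y \<le> CARD('n)" for x
    by (simp add: hamming_def card_mono)
  have "card {x. hamming x y = j} = CARD('n) choose j" for j
  proof -
    have *: "{i. (\<chi> i. if i \<in> S then y $ i + 1 else y $ i) $ i \<noteq> y $ i} = S" for S
    proof (rule set_eqI)
      fix i show "i \<in> {i. (\<chi> i. if i \<in> S then y $ i + 1 else y $ i) $ i \<noteq> y $ i} \<longleftrightarrow> i \<in> S"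
        by (cases "y $ i") auto
    qed
    \<comment> \<open>The inverse flips \<open>y\<close> exactly on the given set of
      coordinates.\<close>
    have "bij_betw (\<lambda>x. {i. x $ i \<noteq> y $ i}) {x. hamming x y = j} {S. S \<subseteq> UNIV \<and> card S = j}"
    proof (rule bij_betw_byWitness[where f' = "\<lambda>S. \<chi> i. if i \<in> S then y $ i + 1 else y $ i"])
      show "(\<lambda>S. \<chi> i. if i \<in> S then y $ i + 1 else y $ i) ` {S. S \<subseteq> UNIV \<and> card S = j}
          \<subseteq> {x. hamming x y = j}"
        unfolding hamming_def by (auto simp only: *)
    qed (use * in \<open>auto simp: hamming_def vec_eq_iff bit_neq_iff\<close>)
    then show ?thesis
      using n_subsets[of "UNIV :: 'n set" j] by (simp add: bij_betw_same_card)
  qed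
  moreover have "(\<Sum>x\<in>UNIV. h (hamming x y)) =
      (\<Sum>j=0..CARD('n). \<Sum>x | x \<in> UNIV \<and> hamming x y = j. h (hamming x y))"
    using le by (intro sum.group[symmetric]) auto
  ultimately show ?thesis
    by simp
qed

lemma integral_mu_poly:
  fixes y :: "bit ^ 'n"
  shows "(\<integral>t. poly p t \<partial>mu CARD('n)) = (\<Sum>x\<in>UNIV. poly p (ham_ip x y)) / 2 ^ CARD('n)"
proof -
  let ?n = "CARD('n)"
  have "(\<Sum>x\<in>UNIV. poly p (ham_ip x y)) =
      (\<Sum>j=0..?n. real (?n choose j) * poly p (1 - 2 * real j / real ?n))"
    unfolding ham_ip_def by (rule sum_hamming_UNIV)
  \<comment> \<open>Distance \<open>j\<close> gives the point of index \<open>?n - j\<close>, so the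
    sum is reversed, using the symmetry of the binomial weights.\<close>
  also have "\<dots> = (\<Sum>j=0..?n. real (?n choose j) * poly p (-1 + 2 * real j / real ?n))"
    by (subst sum.atLeastAtMost_rev, intro sum.cong)
       (auto simp: binomial_symmetric[symmetric] of_nat_diff field_simps)
  finally show ?thesis
    by (subst integral_mu)
       (auto intro!: borel_measurable_continuous_onI continuous_intros)
qed

text \<open>The inner product is affine in the distance, so \<open>p\<close> becomes a polynomial
  \<open>q\<close> in the distance, still of degree at most \<open>\<tau>\<close>; up to that degree
  the moments over \<open>C\<close> are proportional to those over the whole space.\<close>

lemma orthogonal_array_sum_poly:
  fixes C :: "(bit ^ 'n) set" and y :: "bit ^ 'n"
  assumes "orthogonal_array \<tau> C" "degree p \<le> \<tau>"
  shows "(\<Sum>x\<in>C. poly p (ham_ip x y)) = real (card C) * (\<integral>t. poly p t \<partial>mu CARD('n))"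
proof -
  define q where "q = pcompose p [:1, - 2 / real CARD('n):]"
  have q: "poly p (ham_ip x y) = (\<Sum>i\<le>degree q. coeff q i * real (hamming x y) ^ i)" for x
    unfolding poly_altdef[of q, symmetric]
    by (simp add: q_def ham_ip_def poly_pcompose mult.commute)
  have "degree q \<le> \<tau>"
    using assms(2) by (simp add: q_def degree_pcompose)
  then have moment: "(\<Sum>x\<in>C. real (hamming x y) ^ i) =
      real (card C) / 2 ^ CARD('n) * (\<Sum>x\<in>UNIV. real (hamming x y) ^ i)" if "i \<le> degree q" for i
    using sum_hamming_power[OF assms(1), of "{}" i y] that by simp
  have sum_q: "(\<Sum>x\<in>B. poly p (ham_ip x y)) =
      (\<Sum>i\<le>degree q. coeff q i * (\<Sum>x\<in>B. real (hamming x y) ^ i))" for B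
    unfolding q sum_distrib_left by (rule sum.swap)
  have "(\<Sum>x\<in>C. poly p (ham_ip x y)) =
      real (card C) / 2 ^ CARD('n) * (\<Sum>x\<in>UNIV. poly p (ham_ip x y))"
    unfolding sum_q sum_distrib_left[of _ _ "{..degree q}"]
    by (intro sum.cong) (simp_all add: moment)
  then show ?thesis
    using integral_mu_poly[of p y] by simp
qed

section \<open>Antipodes and deep holes\<close>

lemma hamming_eq_CARD_iff: "hamming x y = CARD('n) \<longleftrightarrow> x = (\<chi> i. y $ i + 1)"
  for x y :: "bit ^ 'n"
proof -
  have "hamming x y = CARD('n) \<longleftrightarrow> {i. x $ i \<noteq> y $ i} = UNIV"
    unfolding hamming_def by (metis card_eq_UNIV_imp_eq_UNIV[OF finite])
  also have "\<dots> \<longleftrightarrow> x = (\<chi> i. y $ i + 1)"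
    by (simp add: vec_eq_iff set_eq_iff bit_neq_iff)
  finally show ?thesis .
qed

lemma ham_ip_ge:
  fixes x y :: "bit ^ 'n"
  assumes "hamming x y \<noteq> CARD('n)"
  shows "ham_ip x y \<ge> -1 + 2 / real CARD('n)"
proof -
  have "hamming x y \<le> CARD('n)"
    by (simp add: hamming_def card_mono)
  then have "real (hamming x y) \<le> real CARD('n) - 1"
    using assms by linarith
  then have "2 * real (hamming x y) / real CARD('n) \<le> 2 * (real CARD('n) - 1) / real CARD('n)"
    by (intro divide_right_mono) auto
  then show ?thesis
    by (simp add: ham_ip_def diff_divide_distrib right_diff_distrib)
qed

lemma sum_ham_ip_antipode:
  fixes y z :: "bit ^ 'n" and g :: "real \<Rightarrow> real"
  assumes "z \<in> C" "hamming z y = CARD('n)"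
  shows "(\<Sum>x\<in>C. g (ham_ip x y)) = g (-1) + (\<Sum>x\<in>C - {z}. g (ham_ip x y))"
proof -
  have "ham_ip z y = -1"
    using assms(2) by (simp add: ham_ip_def)
  then show ?thesis
    using assms(1) by (simp add: sum.remove)
qed

text \<open>A bit differs from only one bit, so \<open>z\<close> is the only word antipodal to
  \<open>y\<close>.\<close>

lemma ham_ip_ge_antipode:
  fixes x y z :: "bit ^ 'n"
  assumes "hamming z y = CARD('n)" "x \<noteq> z"
  shows "ham_ip x y \<ge> -1 + 2 / real CARD('n)"
proof (rule ham_ip_ge)
  show "hamming x y \<noteq> CARD('n)"
    using assms unfolding hamming_eq_CARD_iff by blast
qed

text \<open>The minimum over the finite space is attained; this supplies the word \<open>y\<close>
  for the first inequality.\<close>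

lemma deep_holes_nonempty:
  fixes C :: "(bit ^ 'n) set"
  shows "deep_holes C \<noteq> {}"
proof -
  have "cov_rho C \<in> range (\<lambda>y. MAX x\<in>C. ham_ip x y)"
    unfolding cov_rho_def by (rule Min_in) auto
  then show ?thesis
    unfolding deep_holes_def by (metis (mono_tags, lifting) empty_iff mem_Collect_eq rangeE)
qed

section \<open>Positivity of the denominator of \<open>q_bound\<close>\<close>

lemma integral_mu_pos:
  assumes n: "n \<ge> 2" and deg: "degree A < n - 1" and A: "A \<noteq> 0"
  shows "(\<integral>t. poly ([:1, 1:] * [:1 - 2 / real n, 1:] * A ^ 2) t \<partial>mu n) > 0"
proof -
  let ?p = "[:1, 1:] * [:1 - 2 / real n, 1:] * A ^ 2" and ?t = "\<lambda>i. -1 + 2 * real i / real n"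
  have val: "poly ?p (?t i) = 4 * (real i * (real i - 1)) / (real n)\<^sup>2 * (poly A (?t i))\<^sup>2" for i
  proof -
    have "?t i + 1 = 2 * real i / real n" "?t i + 1 - 2 / real n = 2 * (real i - 1) / real n"
      using n by (simp_all add: field_simps)
    moreover have "poly ?p t = (t + 1) * (t + 1 - 2 / real n) * (poly A t)\<^sup>2" for t
      by (simp only: poly_mult poly_power poly_pCons poly_0) (simp add: algebra_simps)
    ultimately show ?thesis
      by (simp only:) (simp add: power2_eq_square)
  qed
  \<comment> \<open>The product is negative only strictly between 0 and 1, where no index lies. It
    vanishes at the indices 0 and 1, which leaves \<open>n - 1\<close> points for testing
    \<open>A\<close>.\<close>
  have nonneg: "real i * (real i - 1) \<ge> 0" for i :: nat
    by (cases i) auto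
  have "\<exists>i\<in>{2..n}. poly A (?t i) \<noteq> 0"
  proof (rule ccontr)
    assume "\<not> ?thesis"
    then have "?t ` {2..n} \<subseteq> {t. poly A t = 0}"
      by auto
    then have "card (?t ` {2..n}) \<le> card {t. poly A t = 0}"
      by (intro card_mono poly_roots_finite A)
    also have "\<dots> \<le> degree A"
      by (rule card_poly_roots_bound[OF A])
    finally have "card (?t ` {2..n}) \<le> degree A" .
    moreover have "card (?t ` {2..n}) = n - 1"
      using n by (subst card_image) (auto simp: inj_on_def)
    ultimately show False
      using deg by simp
  qed
  then obtain i where i: "i \<in> {2..n}" "poly A (?t i) \<noteq> 0"
    by blast
  have "(\<Sum>i=0..n. real (n choose i) * poly ?p (?t i)) > 0"
  proof (rule sum_pos2[where i = i])
    show "0 < real (n choose i) * poly ?p (?t i)"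
      unfolding val using i n by (auto intro!: mult_pos_pos divide_pos_pos)
    show "0 \<le> real (n choose j) * poly ?p (?t j)" for j
      unfolding val using nonneg[of j] by simp
  qed (use i in auto)
  then show ?thesis
    by (subst integral_mu)
       (auto simp del: poly_mult intro!: borel_measurable_continuous_onI continuous_intros)
qed

lemma q_bound_denominator_pos:
  fixes C :: "(bit ^ 'n) set"
  assumes n: "CARD('n) \<ge> 2" and k: "k \<ge> 1" and C: "orthogonal_array (2 * k) C"
    and A: "A \<noteq> 0" "degree A = k - 1"
  shows "real (card C) * (\<integral>t. poly ([:1 - 2 / real CARD('n), 1:] * A ^ 2) t \<partial>mu CARD('n))
    + 2 / real CARD('n) * (poly A (-1))\<^sup>2 > 0"
proof -
  let ?n = "CARD('n)"
  let ?g = "[:1 - 2 / real ?n, 1:] * A ^ 2"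
  have kn: "2 * k \<le> ?n" and "C \<noteq> {}"
    using C by (auto simp: orthogonal_array_def)
  then obtain z where z: "z \<in> C"
    by blast
  define y where "y = (\<chi> i. z $ i + 1)"
  have zy: "hamming z y = ?n"
    by (simp add: hamming_eq_CARD_iff y_def vec_eq_iff)
  have degA: "degree (A\<^sup>2) = 2 * (k - 1)"
    using A by (simp add: degree_power_eq)
  \<comment> \<open>The degree of \<open>?g\<close> is \<open>2 * k - 1\<close>, so the strength
    leaves room for exactly one more linear factor.\<close>
  have deg: "degree ?g \<le> 2 * k" "degree ([:1, 1:] * ?g) \<le> 2 * k"
    using A k degA by (simp_all add: degree_mult_eq del: mult_pCons_left)
  have g: "poly ?g (ham_ip x y) \<ge> 0" if "x \<in> C - {z}" for x
  proof -
    have "poly [:1 - 2 / real ?n, 1:] (ham_ip x y) \<ge> 0"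
      using ham_ip_ge_antipode[OF zy, of x] that by simp
    then show ?thesis
      unfolding poly_mult poly_power by (rule mult_nonneg_nonneg) simp
  qed
  let ?s = "\<Sum>x\<in>C - {z}. poly ?g (ham_ip x y)"
  \<comment> \<open>The antipodal term is \<open>- 2 / ?n\<close> times the square of
    \<open>A\<close> at -1; moved to the other side, it completes the denominator.\<close>
  have s: "real (card C) * (\<integral>t. poly ?g t \<partial>mu ?n) + 2 / real ?n * (poly A (-1))\<^sup>2 = ?s"
    using orthogonal_array_sum_poly[OF C deg(1), of y] sum_ham_ip_antipode[OF z zy, of "poly ?g"]
    by (simp add: field_simps)
  have "?s \<noteq> 0"
  proof
    assume "?s = 0"
    then have zero: "poly ?g (ham_ip x y) = 0" if "x \<in> C - {z}" for x
      using g that by (subst (asm) sum_nonneg_eq_0_iff) auto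
    \<comment> \<open>The factor \<open>[:1, 1:]\<close> removes the antipodal term as well, so that
      the sum over all of \<open>C\<close> vanishes.\<close>
    have "(\<Sum>x\<in>C - {z}. poly ([:1, 1:] * ?g) (ham_ip x y)) = 0"
      by (intro sum.neutral ballI) (simp only: poly_mult[of "[:1, 1:]"] zero mult_zero_right)
    then have "(\<Sum>x\<in>C. poly ([:1, 1:] * ?g) (ham_ip x y)) = 0"
      by (subst sum_ham_ip_antipode[OF z zy]) (simp add: poly_mult del: mult_pCons_left)
    then have "(\<integral>t. poly ([:1, 1:] * ?g) t \<partial>mu ?n) = 0"
      using orthogonal_array_sum_poly[OF C deg(2), of y] \<open>C \<noteq> {}\<close> by simp
    moreover have "(\<integral>t. poly ([:1, 1:] * ?g) t \<partial>mu ?n) > 0"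
      using integral_mu_pos[OF n _ A(1)] A(2) k kn by (simp only: mult.assoc)
    ultimately show False
      by simp
  qed
  moreover have "?s \<ge> 0"
    using g by (rule sum_nonneg)
  ultimately show ?thesis
    unfolding s by simp
qed

section \<open>The two inequalities and their equivalence\<close>

lemma poly_test_poly:
  "poly (test_poly n r A) t = (t + 1 - 2 / real n) * (t - r) * (poly A t)\<^sup>2"
proof -
  have "poly [:1 - 2 / real n, 1:] t = t + 1 - 2 / real n" "poly [:- r, 1:] t = t - r"
    by simp_all
  then show ?thesis
    by (simp only: test_poly_def poly_mult poly_power)
qed

text \<open>The factor \<open>t - r\<close> makes everything affine in \<open>r\<close>; with
  \<open>M\<close> the size of the code, the two brackets are the numerator and the denominator of
  \<open>q_bound\<close>.\<close>

lemma test_poly_affine: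
  "(\<integral>t. poly (test_poly n r A) t \<partial>mu n) * M - poly (test_poly n r A) (-1) =
    (M * (\<integral>t. t * (t + 1 - 2 / real n) * (poly A t)\<^sup>2 \<partial>mu n) - 2 / real n * (poly A (-1))\<^sup>2)
    - r * (M * (\<integral>t. (t + 1 - 2 / real n) * (poly A t)\<^sup>2 \<partial>mu n) + 2 / real n * (poly A (-1))\<^sup>2)"
proof -
  define g where "g t = (t + 1 - 2 / real n) * (poly A t)\<^sup>2" for t
  have g: "g \<in> borel_measurable borel"
    unfolding g_def by (intro borel_measurable_continuous_onI continuous_intros)
  have "(\<integral>t. poly (test_poly n r A) t \<partial>mu n) = (\<integral>t. t * g t - r * g t \<partial>mu n)"
    by (intro Bochner_Integration.integral_cong)
      (simp_all only: poly_test_poly g_def flip: left_diff_distrib, simp_all add: ac_simps)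
  also have "\<dots> = (\<integral>t. t * g t \<partial>mu n) - r * (\<integral>t. g t \<partial>mu n)"
    using g by (simp add: integral_mu right_diff_distrib sum_subtractf diff_divide_distrib
        sum_distrib_left mult.left_commute)
  finally have "(\<integral>t. poly (test_poly n r A) t \<partial>mu n) =
      (\<integral>t. t * g t \<partial>mu n) - r * (\<integral>t. g t \<partial>mu n)" .
  moreover have "poly (test_poly n r A) (-1) = 2 / real n * (1 + r) * (poly A (-1))\<^sup>2"
    by (simp add: poly_test_poly ring_distribs add_divide_distrib diff_divide_distrib)
  ultimately show ?thesis
    unfolding g_def mult.assoc by (simp only:) (simp add: algebra_simps add_divide_distrib)
qed

lemma test_poly_bound:
  fixes C :: "(bit ^ 'n) set"
  assumes k: "k \<ge> 1" and C: "orthogonal_array (2 * k) C"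
    and D: "deep_holes C \<subseteq> antipodes C"
    and A: "A \<noteq> 0" "degree A = k - 1"
  shows "(\<integral>t. poly (test_poly CARD('n) (cov_rho C) A) t \<partial>mu CARD('n)) * real (card C)
    - poly (test_poly CARD('n) (cov_rho C) A) (-1) \<le> 0"
proof -
  let ?f = "test_poly CARD('n) (cov_rho C) A"
  obtain y where y: "y \<in> deep_holes C"
    using deep_holes_nonempty by blast
  with D obtain z where z: "z \<in> C" and zy: "hamming z y = CARD('n)"
    by (auto simp: antipodes_def)
  have "degree (A\<^sup>2) = 2 * (k - 1)"
    using A by (simp add: degree_power_eq)
  \<comment> \<open>Two linear factors and the square of \<open>A\<close> give degree
    \<open>2 * k\<close>, the full strength.\<close>
  then have deg: "degree ?f \<le> 2 * k"
    using A k by (simp add: test_poly_def degree_mult_eq del: mult_pCons_left mult_pCons_right)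
  have "poly ?f (ham_ip x y) \<le> 0" if x: "x \<in> C - {z}" for x
  proof -
    \<comment> \<open>At a deep hole the largest inner product with a codeword is
      \<open>cov_rho C\<close> itself.\<close>
    have "ham_ip x y \<le> cov_rho C"
      using y x by (auto simp: deep_holes_def dest!: sym[of _ "cov_rho C"])
    moreover have "ham_ip x y \<ge> -1 + 2 / real CARD('n)"
      using ham_ip_ge_antipode[OF zy] x by auto
    ultimately have "(ham_ip x y + 1 - 2 / real CARD('n)) * (ham_ip x y - cov_rho C) \<le> 0"
      by (intro mult_nonneg_nonpos) auto
    then have "(ham_ip x y + 1 - 2 / real CARD('n)) * (ham_ip x y - cov_rho C)
      * (poly A (ham_ip x y))\<^sup>2 \<le> 0"
      by (rule mult_nonpos_nonneg) simp
    then show ?thesis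
      by (simp only: poly_test_poly)
  qed
  then have "(\<Sum>x\<in>C - {z}. poly ?f (ham_ip x y)) \<le> 0"
    by (rule sum_nonpos)
  then show ?thesis
    using orthogonal_array_sum_poly[OF C deg, of y] sum_ham_ip_antipode[OF z zy, of "poly ?f"]
    by (simp add: mult.commute)
qed

theorem theorem4p4:
  fixes C :: "(bit ^ 'n) set" and k :: nat and A :: "real poly"
  assumes "CARD('n) \<ge> 2"
    and "k \<ge> 1"
    and "orthogonal_array (2 * k) C"
    and "deep_holes C \<subseteq> antipodes C"
    and "A \<noteq> 0" and "degree A = k - 1"
  shows "(\<integral>t. poly (test_poly CARD('n) (cov_rho C) A) t \<partial>mu CARD('n)) * real (card C)
            - poly (test_poly CARD('n) (cov_rho C) A) (-1) \<le> 0
    \<and> cov_rho C \<ge> q_bound CARD('n) (card C) A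
    \<and> (\<forall>r::real.
          (\<integral>t. poly (test_poly CARD('n) r A) t \<partial>mu CARD('n)) * real (card C)
            - poly (test_poly CARD('n) r A) (-1) \<le> 0
          \<longleftrightarrow> r \<ge> q_bound CARD('n) (card C) A)"
proof -
  let ?n = "CARD('n)"
  let ?b = "\<integral>t. (t + 1 - 2 / real ?n) * (poly A t)\<^sup>2 \<partial>mu ?n"
  have "poly ([:1 - 2 / real ?n, 1:] * A ^ 2) = (\<lambda>t. (t + 1 - 2 / real ?n) * (poly A t)\<^sup>2)"
    by (auto simp: algebra_simps)
  then have pos: "real (card C) * ?b + 2 / real ?n * (poly A (-1))\<^sup>2 > 0"
    using q_bound_denominator_pos[OF assms(1,2,3,5,6)] by simp
  \<comment> \<open>As the denominator is positive, the sign of the affine expression tells on which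
    side of the quotient \<open>r\<close> lies; \<open>r = cov_rho C\<close> then gives the second
    inequality.\<close>
  have iff: "(\<integral>t. poly (test_poly ?n r A) t \<partial>mu ?n) * real (card C)
      - poly (test_poly ?n r A) (-1) \<le> 0 \<longleftrightarrow> r \<ge> q_bound ?n (card C) A" for r
    using pos by (simp add: test_poly_affine q_bound_def Let_def pos_divide_le_eq)
  show ?thesis
    using test_poly_bound[OF assms(2-6)] iff by blast
qed

end
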